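(* If $G=(U,V,E)$ is a stochastic graph with downward-closed probing constraints $(\mathcal{C}_v)_{v\in V}$, then $\mathrm{OPT}(G)\le\mathrm{LPOPT}(G)$.
   Context: A stochastic graph is a finite bipartite graph $G=(U,V,E)$, $E=U\times V$, with nonnegative weights $(w_e)$ and probabilities $(p_e)\subseteq[0,1]$; each edge $e$ is independently active with probability $p_e$, its state hidden until probed. $S^{( * )}$: tuples of pairwise distinct elements of $S$ including the empty string $\lambda$; $\partial(v)$: edges at $v$. $\mathcal{C}_v\subseteq\partial(v)^{( * )}$ is downward-closed: closed under taking substrings and permutations. Probe-commit model: if a probed edge is active, the algorithm must irrevocably decide whether to add it to its matching before the next probe; only probed active edges can be added; output is a matching. An offline probing algorithm knows $G$ and adaptively (possibly randomly) probes edges in any order, so that for each $v$ the probed edges of $\partial(v)$, in order, form a string of $\mathcal{C}_v$. $\mathrm{OPT}(G)$ is the supremum over offline probing algorithms of the expected weight of the output matching. For $\bm e=(e_1,\dots,e_k)$: $g(\bm e)=\prod_{j}(1-p_{e_j})$, $g(\lambda)=1$, $\bm e_{<e_j}=(e_1,\dots,e_{j-1})$, $\mathrm{val}(\bm e)=\sum_j p_{e_j}w_{e_j}g(\bm e_{<e_j})$. $\mathrm{LPOPT}(G)$ is the optimum of LP-config: variables $x_v(\bm e)\ge0$ ($v\in V$, $\bm e\in\mathcal{C}_v$); maximize $\sum_{v}\sum_{\bm e\in\mathcal{C}_v}\mathrm{val}(\bm e)x_v(\bm e)$ subject to $\sum_{v\in V}\sum_{\bm e\in\mathcal{C}_v:(u,v)\in\bm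 e}p_{u,v}g(\bm e_{<(u,v)})x_v(\bm e)\le1$ for all $u\in U$, and $\sum_{\bm e\in\mathcal{C}_v}x_v(\bm e)=1$ for all $v\in V$. *)

theory Defs
  imports "HOL-Probability.Probability" "HOL-Library.Sublist"
begin

section \<open>Stochastic graphs and probing constraints\<close>

text \<open>
  The edge set of a stochastic graph is always \<^term>\<open>U \<times> V\<close>, so it is not a separate parameter.
\<close>

definition stochastic_graph ::
  "'u set \<Rightarrow> 'v set \<Rightarrow> ('u \<times> 'v \<Rightarrow> real) \<Rightarrow> ('u \<times> 'v \<Rightarrow> real) \<Rightarrow> bool" where
  "stochastic_graph U V w p \<longleftrightarrow>
     finite U \<and> finite V \<and>
     (\<forall>e\<in>U \<times> V. 0 \<le> w e) \<and> (\<forall>e\<in>U \<times> V. 0 \<le> p e \<and> p e \<le> 1)"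

definition distinct_strings :: "'a set \<Rightarrow> 'a list set" where
  "distinct_strings S = {es. distinct es \<and> set es \<subseteq> S}"

definition incident :: "'u set \<Rightarrow> 'v \<Rightarrow> ('u \<times> 'v) set" where
  "incident U v = U \<times> {v}"

text \<open>
  Substrings are contiguous sublists; together with closure under permutations this gives closure
  under arbitrary subsequences.
\<close>

definition downward_closed :: "'a list set \<Rightarrow> bool" where
  "downward_closed C \<longleftrightarrow>
     (\<forall>es\<in>C. \<forall>es'. sublist es' es \<longrightarrow> es' \<in> C) \<and>
     (\<forall>es\<in>C. \<forall>es'. mset es' = mset es \<longrightarrow> es' \<in> C)"

definition probing_constraints ::
  "'u set \<Rightarrow> 'v set \<Rightarrow> ('v \<Rightarrow> ('u \<times> 'v) list set) \<Rightarrow> bool" where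
  "probing_constraints U V C \<longleftrightarrow>
     (\<forall>v\<in>V. C v \<subseteq> distinct_strings (incident U v) \<and> downward_closed (C v))"

definition matching :: "('u \<times> 'v) set \<Rightarrow> bool" where
  "matching M \<longleftrightarrow> (\<forall>e\<in>M. \<forall>f\<in>M. e \<noteq> f \<longrightarrow> fst e \<noteq> fst f \<and> snd e \<noteq> snd f)"


section \<open>Offline probing algorithms\<close>

text \<open>
  An adaptive randomized algorithm is a decision tree. \<open>Randomize\<close> draws the way to continue.
  \<open>Probe e t A\<close> probes \<open>e\<close>: if \<open>e\<close> is inactive, the algorithm continues with \<open>t\<close>; if \<open>e\<close> is active,
  it draws from \<open>A\<close> the irrevocable decision whether to add \<open>e\<close> to its matching, together with the
  way to continue. Edge states can influence the tree only through probes, so they are hidden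
  until then. No algorithm meeting the constraints probes more than \<^term>\<open>card (U \<times> V)\<close> edges, so
  well-foundedness of the tree is no restriction. Neither is the use of discrete distributions: up
  to the truncation at that depth there are only finitely many deterministic trees to choose from,
  whatever the source of randomness.
\<close>

datatype 'e algorithm =
    Halt
  | Randomize "'e algorithm pmf"
  | Probe 'e "'e algorithm" "(bool \<times> 'e algorithm) pmf"

text \<open>
  Joint distribution of the string of probed edges, in order, and the output, when the edge states
  are \<open>act\<close>.
\<close>

primrec run :: "('e \<Rightarrow> bool) \<Rightarrow> 'e algorithm \<Rightarrow> ('e list \<times> 'e set) pmf" where
  "run act Halt = return_pmf ([], {})"
| "run act (Randomize A) = join_pmf (map_pmf (run act) A)"
| "run act (Probe e t A) =
     (if act e
      then bind_pmf (map_pmf (map_prod id (run act)) A)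
             (\<lambda>(accept, r). map_pmf (\<lambda>(es, M). (e # es, if accept then insert e M else M)) r)
      else map_pmf (\<lambda>(es, M). (e # es, M)) (run act t))"

definition edge_states ::
  "'u set \<Rightarrow> 'v set \<Rightarrow> ('u \<times> 'v \<Rightarrow> real) \<Rightarrow> ('u \<times> 'v \<Rightarrow> bool) pmf" where
  "edge_states U V p = Pi_pmf (U \<times> V) False (\<lambda>e. bernoulli_pmf (p e))"

definition outcome ::
  "'u set \<Rightarrow> 'v set \<Rightarrow> ('u \<times> 'v \<Rightarrow> real) \<Rightarrow> ('u \<times> 'v) algorithm \<Rightarrow>
   (('u \<times> 'v) list \<times> ('u \<times> 'v) set) pmf" where
  "outcome U V p t = bind_pmf (edge_states U V p) (\<lambda>act. run act t)"

text \<open>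
  No edge is probed twice, since the strings in \<open>C v\<close> are distinct.
\<close>

definition offline_algorithms ::
  "'u set \<Rightarrow> 'v set \<Rightarrow> ('u \<times> 'v \<Rightarrow> real) \<Rightarrow> ('v \<Rightarrow> ('u \<times> 'v) list set) \<Rightarrow>
   ('u \<times> 'v) algorithm set" where
  "offline_algorithms U V p C =
     {t. \<forall>(es, M)\<in>set_pmf (outcome U V p t).
           set es \<subseteq> U \<times> V \<and>
           (\<forall>v\<in>V. filter (\<lambda>e. e \<in> incident U v) es \<in> C v) \<and>
           matching M}"

definition expected_weight ::
  "'u set \<Rightarrow> 'v set \<Rightarrow> ('u \<times> 'v \<Rightarrow> real) \<Rightarrow> ('u \<times> 'v \<Rightarrow> real) \<Rightarrow> ('u \<times> 'v) algorithm \<Rightarrow> real" where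
  "expected_weight U V w p t =
     measure_pmf.expectation (outcome U V p t) (\<lambda>(es, M). \<Sum>e\<in>M. w e)"

text \<open>
  Suprema are taken in the extended reals, so that no junk value arises for empty \<open>C v\<close>.
\<close>

definition OPT ::
  "'u set \<Rightarrow> 'v set \<Rightarrow> ('u \<times> 'v \<Rightarrow> real) \<Rightarrow> ('u \<times> 'v \<Rightarrow> real) \<Rightarrow>
   ('v \<Rightarrow> ('u \<times> 'v) list set) \<Rightarrow> ereal" where
  "OPT U V w p C = (SUP t\<in>offline_algorithms U V p C. ereal (expected_weight U V w p t))"


section \<open>The configuration LP\<close>

definition before :: "'e list \<Rightarrow> 'e \<Rightarrow> 'e list" where
  "before es e = takeWhile (\<lambda>f. f \<noteq> e) es"

definition inactive_prob :: "('e \<Rightarrow> real) \<Rightarrow> 'e list \<Rightarrow> real" where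
  "inactive_prob p es = (\<Prod>e\<leftarrow>es. 1 - p e)"

definition val :: "('e \<Rightarrow> real) \<Rightarrow> ('e \<Rightarrow> real) \<Rightarrow> 'e list \<Rightarrow> real" where
  "val w p es = (\<Sum>e\<leftarrow>es. p e * w e * inactive_prob p (before es e))"

definition LP_feasible ::
  "'u set \<Rightarrow> 'v set \<Rightarrow> ('u \<times> 'v \<Rightarrow> real) \<Rightarrow> ('v \<Rightarrow> ('u \<times> 'v) list set) \<Rightarrow>
   ('v \<Rightarrow> ('u \<times> 'v) list \<Rightarrow> real) \<Rightarrow> bool" where
  "LP_feasible U V p C x \<longleftrightarrow>
     (\<forall>v\<in>V. \<forall>es\<in>C v. 0 \<le> x v es) \<and>
     (\<forall>u\<in>U. (\<Sum>v\<in>V. \<Sum>es\<in>{es \<in> C v. (u, v) \<in> set es}.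
               p (u, v) * inactive_prob p (before es (u, v)) * x v es) \<le> 1) \<and>
     (\<forall>v\<in>V. (\<Sum>es\<in>C v. x v es) = 1)"

definition LP_objective ::
  "'v set \<Rightarrow> ('u \<times> 'v \<Rightarrow> real) \<Rightarrow> ('u \<times> 'v \<Rightarrow> real) \<Rightarrow> ('v \<Rightarrow> ('u \<times> 'v) list set) \<Rightarrow>
   ('v \<Rightarrow> ('u \<times> 'v) list \<Rightarrow> real) \<Rightarrow> real" where
  "LP_objective V w p C x = (\<Sum>v\<in>V. \<Sum>es\<in>C v. val w p es * x v es)"

definition LPOPT ::
  "'u set \<Rightarrow> 'v set \<Rightarrow> ('u \<times> 'v \<Rightarrow> real) \<Rightarrow> ('u \<times> 'v \<Rightarrow> real) \<Rightarrow>
   ('v \<Rightarrow> ('u \<times> 'v) list set) \<Rightarrow> ereal" where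
  "LPOPT U V w p C = (SUP x\<in>{x. LP_feasible U V p C x}. ereal (LP_objective V w p C x))"

end

theory Submission
  imports Defs
begin

text \<open>
  Fix an algorithm and a vertex \<open>v\<close>. From the decision tree one reads off a distribution over strings
  in \<open>C v\<close>, all drawn before any edge at \<open>v\<close> is probed, such that the first active edge of the drawn
  string has exactly the distribution of the edge that the algorithm matches to \<open>v\<close>. Taking these
  distributions as \<open>x v\<close>, the left-hand side of the LP constraint at \<open>u\<close> is the
  probability that \<open>u\<close> is matched, and the LP objective equals the expected weight.

  The only interesting node of the tree is a probe of an edge \<open>e\<close> at \<open>v\<close>. Let \<open>a\<close> be the probability of
  accepting \<open>e\<close> when it is active, and let \<open>q\<close> and \<open>q'\<close> be the distributions of the matched edge after
  \<open>e\<close> was inactive, respectively active and rejected. The matched edge is distributed as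
  \<open>p e a \<delta>\<^sub>e + p e (1 - a) q' + (1 - p e) q\<close>, which equals
  \<open>a (p e \<delta>\<^sub>e + (1 - p e) q) + (1 - a) (p e q' + (1 - p e) q)\<close>.
  Hence one can decide first whether \<open>e\<close> would be accepted; if so, \<open>e\<close> is put in front of the string for
  the inactive branch, and otherwise \<open>e\<close> is dropped and its state is simulated. Dropping edges is
  where downward closure is used.
\<close>

text \<open>Deferred decisions: instead of fixing all edge states in advance, each probe tosses a
  fresh coin. Without a global state, the branches below a probe can be treated as independent
  algorithms in inductions on the tree.\<close>

primrec lazy_run :: "('e \<Rightarrow> real) \<Rightarrow> 'e algorithm \<Rightarrow> ('e list \<times> 'e set) pmf" where
  "lazy_run p Halt = return_pmf ([], {})"
| "lazy_run p (Randomize A) = join_pmf (map_pmf (lazy_run p) A)"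
| "lazy_run p (Probe e t A) =
     bind_pmf (bernoulli_pmf (p e)) (\<lambda>active.
       if active
       then bind_pmf (map_pmf (map_prod id (lazy_run p)) A)
              (\<lambda>(accept, r). map_pmf (\<lambda>(es, M). (e # es, if accept then insert e M else M)) r)
       else map_pmf (\<lambda>(es, M). (e # es, M)) (lazy_run p t))"

text \<open>
  If \<open>e\<close> is active almost surely, the branch \<open>t\<close> is unreachable, so the probing constraints say nothing
  about it; hence the string \<open>[e]\<close> in that case.
\<close>

primrec nonadaptive :: "('e \<Rightarrow> real) \<Rightarrow> 'e set \<Rightarrow> 'e algorithm \<Rightarrow> 'e list pmf" where
  "nonadaptive p I Halt = return_pmf []"
| "nonadaptive p I (Randomize A) = join_pmf (map_pmf (nonadaptive p I) A)"
| "nonadaptive p I (Probe e t A) =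
     bind_pmf (map_pmf (map_prod id (nonadaptive p I)) A) (\<lambda>(accept, r).
       if e \<in> I \<and> accept
       then if False \<in> set_pmf (bernoulli_pmf (p e))
            then map_pmf (Cons e) (nonadaptive p I t) else return_pmf [e]
       else bind_pmf (bernoulli_pmf (p e)) (\<lambda>active. if active then r else nonadaptive p I t))"

text \<open>For distinct \<open>es\<close>, the mass at \<open>Some e\<close> is the LP coefficient
  \<open>p e * inactive_prob p (before es e)\<close>, so averaging over a random string turns LP
  expressions into probabilities.\<close>

primrec first_active :: "('e \<Rightarrow> real) \<Rightarrow> 'e list \<Rightarrow> 'e option pmf" where
  "first_active p [] = return_pmf None"
| "first_active p (e # es) =
     bind_pmf (bernoulli_pmf (p e)) (\<lambda>active. if active then return_pmf (Some e) else first_active p es)"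

text \<open>For a matching and the edges at one vertex, \<open>M \<inter> I\<close> has at most one
  element, so \<open>SOME\<close> involves no real choice.\<close>

definition matched_edge :: "'e set \<Rightarrow> 'e set \<Rightarrow> 'e option" where
  "matched_edge I M = (if M \<inter> I = {} then None else Some (SOME e. e \<in> M \<inter> I))"

section \<open>Unfolding equations for the trees\<close>

lemma run_Randomize: "run act (Randomize A) = bind_pmf A (run act)"
  by (simp add: join_eq_bind_pmf bind_map_pmf)

lemma lazy_run_Randomize: "lazy_run p (Randomize A) = bind_pmf A (lazy_run p)"
  by (simp add: join_eq_bind_pmf bind_map_pmf)

lemma nonadaptive_Randomize: "nonadaptive p I (Randomize A) = bind_pmf A (nonadaptive p I)"
  by (simp add: join_eq_bind_pmf bind_map_pmf)

text \<open>Primitive recursion through \<open>pmf\<close> and pairs forces the recursive calls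
  under \<open>map_pmf\<close> and \<open>map_prod\<close>; the plain monadic form is the one used
  in the proofs.\<close>

lemma run_Probe:
  "run act (Probe e t A) =
     (if act e
      then bind_pmf A (\<lambda>(accept, s).
             map_pmf (\<lambda>(es, M). (e # es, if accept then insert e M else M)) (run act s))
      else map_pmf (\<lambda>(es, M). (e # es, M)) (run act t))"
  by (simp add: bind_map_pmf case_prod_beta')

lemma lazy_run_Probe:
  "lazy_run p (Probe e t A) =
     bind_pmf (bernoulli_pmf (p e)) (\<lambda>active.
       if active
       then bind_pmf A (\<lambda>(accept, s).
              map_pmf (\<lambda>(es, M). (e # es, if accept then insert e M else M)) (lazy_run p s))
       else map_pmf (\<lambda>(es, M). (e # es, M)) (lazy_run p t))"
  by (simp add: bind_map_pmf case_prod_beta' cong: if_cong)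

lemma nonadaptive_Probe:
  "nonadaptive p I (Probe e t A) =
     bind_pmf A (\<lambda>(accept, s).
       if e \<in> I \<and> accept
       then if False \<in> set_pmf (bernoulli_pmf (p e))
            then map_pmf (Cons e) (nonadaptive p I t) else return_pmf [e]
       else bind_pmf (bernoulli_pmf (p e))
              (\<lambda>active. if active then nonadaptive p I s else nonadaptive p I t))"
  by (simp add: bind_map_pmf case_prod_beta' cong: if_cong)

lemma lazy_run_Probe_activeI:
  assumes "True \<in> set_pmf (bernoulli_pmf (p e))" "(accept, s) \<in> set_pmf A"
    "(es, M) \<in> set_pmf (lazy_run p s)"
  shows "(e # es, if accept then insert e M else M) \<in> set_pmf (lazy_run p (Probe e t A))"
  unfolding lazy_run_Probe set_bind_pmf
  by (rule UN_I[OF assms(1)]) (use assms(2,3) in force)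

lemma lazy_run_Probe_inactiveI:
  assumes "False \<in> set_pmf (bernoulli_pmf (p e))" "(es, M) \<in> set_pmf (lazy_run p t)"
  shows "(e # es, M) \<in> set_pmf (lazy_run p (Probe e t A))"
  unfolding lazy_run_Probe set_bind_pmf
  by (rule UN_I[OF assms(1)]) (use assms(2) in force)

lemmas [simp del] = run.simps(2,3) lazy_run.simps(2,3) nonadaptive.simps(2,3)

section \<open>Sampling edge states on demand\<close>

lemma run_output_subset: "(es, M) \<in> set_pmf (run act t) \<Longrightarrow> M \<subseteq> set es"
proof (induction t arbitrary: es M)
  case (Randomize A)
  then show ?case by (auto simp: run_Randomize)
next
  case (Probe e t A)
  show ?case
  proof (cases "act e")
    case True
    then obtain accept s es' M' where "(accept, s) \<in> set_pmf A" "(es', M') \<in> set_pmf (run act s)"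
      "es = e # es'" "M = (if accept then insert e M' else M')"
      using Probe.prems by (auto simp: run_Probe)
    then show ?thesis
      using Probe.IH(2)[of "(accept, s)" s es' M'] by auto
  next
    case False
    then show ?thesis
      using Probe.prems Probe.IH(1) by (fastforce simp: run_Probe)
  qed
qed simp

text \<open>A run reads \<open>act\<close> only at the edges it probes, so both states lead through
  the same branches. The hypothesis concerns \<open>act\<close> alone and hence only branches that
  \<open>act\<close> can reach.\<close>

lemma run_fun_upd_unprobed:
  assumes "\<And>es M. (es, M) \<in> set_pmf (run act t) \<Longrightarrow> e \<notin> set es"
  shows "run (act(e := b)) t = run act t"
  using assms
proof (induction t)
  case (Randomize A)
  show ?case
    unfolding run_Randomize
    by (intro bind_pmf_cong refl Randomize.IH Randomize.prems) (auto simp: run_Randomize)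
next
  case (Probe f t A)
  \<comment> \<open>Some outcome exists since supports are nonempty. Its string begins with
    \<open>f\<close>, so the hypothesis gives \<open>f \<noteq> e\<close>.\<close>
  obtain es M where esM: "(es, M) \<in> set_pmf (run act (Probe f t A))"
    using set_pmf_not_empty[of "run act (Probe f t A)"] by fastforce
  have "f \<in> set es"
    using esM by (auto simp: run_Probe split: if_splits)
  then have "f \<noteq> e"
    using Probe.prems[OF esM] by auto
  show ?case
  proof (cases "act f")
    case True
    have "run (act(e := b)) s = run act s" if "(accept, s) \<in> set_pmf A" for accept s
    proof (rule Probe.IH(2)[OF that])
      show "s \<in> Basic_BNFs.snds (accept, s)" by simp
      fix es M assume "(es, M) \<in> set_pmf (run act s)"
      then have "\<exists>M'. (f # es, M') \<in> set_pmf (run act (Probe f t A))"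
        using that True by (force simp: run_Probe)
      then show "e \<notin> set es"
        using Probe.prems by fastforce
    qed
    moreover have "(act(e := b)) f"
      using True \<open>f \<noteq> e\<close> by simp
    ultimately show ?thesis
      unfolding run_Probe using True by (auto intro!: bind_pmf_cong simp del: fun_upd_apply)
  next
    case False
    have "run (act(e := b)) t = run act t"
    proof (rule Probe.IH(1))
      fix es M assume "(es, M) \<in> set_pmf (run act t)"
      then have "(f # es, M) \<in> set_pmf (run act (Probe f t A))"
        using False by (force simp: run_Probe)
      then show "e \<notin> set es"
        using Probe.prems by fastforce
    qed
    moreover have "\<not> (act(e := b)) f"
      using False \<open>f \<noteq> e\<close> by simp
    ultimately show ?thesis
      unfolding run_Probe using False by (simp del: fun_upd_apply)
  qed
qed simp

text \<open>After a probe of \<open>e\<close>, distinctness keeps the subtree from reading the state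
  of \<open>e\<close> again, so it depends only on the independent states of \<open>E - {e}\<close>.
  This is why the induction generalizes over \<open>E\<close>.\<close>

lemma run_Pi_pmf_eq_lazy_run:
  assumes "finite E"
    and "\<And>act es M. act \<in> set_pmf (Pi_pmf E False (\<lambda>e. bernoulli_pmf (p e))) \<Longrightarrow>
           (es, M) \<in> set_pmf (run act t) \<Longrightarrow> distinct es \<and> set es \<subseteq> E"
  shows "bind_pmf (Pi_pmf E False (\<lambda>e. bernoulli_pmf (p e))) (\<lambda>act. run act t) = lazy_run p t"
  using assms
proof (induction t arbitrary: E)
  case Halt
  then show ?case by simp
next
  case (Randomize A)
  show ?case
    unfolding run_Randomize lazy_run_Randomize
  proof (subst bind_commute_pmf, intro bind_pmf_cong refl)
    fix t assume t: "t \<in> set_pmf A"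
    show "bind_pmf (Pi_pmf E False (\<lambda>e. bernoulli_pmf (p e))) (\<lambda>act. run act t) = lazy_run p t"
    proof (rule Randomize.IH[OF t Randomize.prems(1)])
      fix act es M
      assume "act \<in> set_pmf (Pi_pmf E False (\<lambda>e. bernoulli_pmf (p e)))"
        and "(es, M) \<in> set_pmf (run act t)"
      then show "distinct es \<and> set es \<subseteq> E"
        using t by (intro Randomize.prems(2)) (auto simp: run_Randomize)
    qed
  qed
next
  case (Probe e t A)
  let ?\<Pi> = "\<lambda>E. Pi_pmf E False (\<lambda>e. bernoulli_pmf (p e))"
  obtain act where act: "act \<in> set_pmf (?\<Pi> E)"
    using set_pmf_not_empty[of "?\<Pi> E"] by blast
  obtain es M where esM: "(es, M) \<in> set_pmf (run act (Probe e t A))"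
    using set_pmf_not_empty[of "run act (Probe e t A)"] by fastforce
  have "e \<in> set es"
    using esM by (auto simp: run_Probe split: if_splits)
  then have "e \<in> E"
    using Probe.prems(2)[OF act esM] by auto
  define E' where "E' = E - {e}"
  have E': "E = insert e E'" "e \<notin> E'" "finite E'"
    using \<open>e \<in> E\<close> Probe.prems(1) by (auto simp: E'_def)
  have Pi_E: "?\<Pi> E = bind_pmf (bernoulli_pmf (p e)) (\<lambda>b. map_pmf (\<lambda>act. act(e := b)) (?\<Pi> E'))"
    using E' by (simp add: Pi_pmf_insert' map_pmf_def)
  have upd: "act(e := b) \<in> set_pmf (?\<Pi> E)"
    if "act \<in> set_pmf (?\<Pi> E')" "b \<in> set_pmf (bernoulli_pmf (p e))" for act b
    using that unfolding Pi_E set_bind_pmf set_map_pmf by blast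
  \<comment> \<open>States drawn for \<open>E'\<close> have the default value \<open>False\<close>
    at \<open>e\<close>, so resetting \<open>e\<close> to \<open>False\<close> undoes any update
    there.\<close>
  have default: "act = (act(e := b))(e := False)" if "act \<in> set_pmf (?\<Pi> E')" for act b
    using that E' set_Pi_pmf_subset[of E' False] by (fastforce simp: fun_eq_iff)
  \<comment> \<open>The string after \<open>e\<close> avoids \<open>e\<close>, so the run of
    \<open>s\<close> is unchanged when \<open>e\<close> is reset to \<open>False\<close>, that is,
    when the states are drawn for \<open>E'\<close> only.\<close>
  have active_branch: "run (act(e := True)) s = run act s \<and>
      (\<forall>(es, M) \<in> set_pmf (run act s). distinct es \<and> set es \<subseteq> E')"
    if "act \<in> set_pmf (?\<Pi> E')" "True \<in> set_pmf (bernoulli_pmf (p e))" "(accept, s) \<in> set_pmf A"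
    for act accept s
  proof -
    have sub: "distinct (e # es) \<and> set (e # es) \<subseteq> E"
      if "(es, M) \<in> set_pmf (run (act(e := True)) s)" for es M
    proof -
      have "\<exists>M'. (e # es, M') \<in> set_pmf (run (act(e := True)) (Probe e t A))"
        using that \<open>(accept, s) \<in> set_pmf A\<close> by (force simp: run_Probe)
      then show ?thesis
        using Probe.prems(2)[OF upd[OF \<open>act \<in> _\<close> \<open>True \<in> _\<close>]] by blast
    qed
    have "run ((act(e := True))(e := False)) s = run (act(e := True)) s"
      by (rule run_fun_upd_unprobed) (use sub in auto)
    then have "run (act(e := True)) s = run act s"
      using default[OF \<open>act \<in> _\<close>] by metis
    then show ?thesis
      using sub E' by auto
  qed
  have inactive_branch: "run (act(e := False)) t = run act t \<and>
      (\<forall>(es, M) \<in> set_pmf (run act t). distinct es \<and> set es \<subseteq> E')"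
    if "act \<in> set_pmf (?\<Pi> E')" "False \<in> set_pmf (bernoulli_pmf (p e))" for act
  proof -
    have sub: "distinct (e # es) \<and> set (e # es) \<subseteq> E"
      if "(es, M) \<in> set_pmf (run (act(e := False)) t)" for es M
    proof -
      have "(e # es, M) \<in> set_pmf (run (act(e := False)) (Probe e t A))"
        using that by (force simp: run_Probe)
      then show ?thesis
        using Probe.prems(2)[OF upd[OF \<open>act \<in> _\<close> \<open>False \<in> _\<close>]] by blast
    qed
    have "act(e := False) = act"
      using default[OF \<open>act \<in> _\<close>, of False] by simp
    then show ?thesis
      using sub E' by auto
  qed
  have "bind_pmf (?\<Pi> E) (\<lambda>act. run act (Probe e t A)) =
      bind_pmf (bernoulli_pmf (p e)) (\<lambda>b. bind_pmf (?\<Pi> E') (\<lambda>act. run (act(e := b)) (Probe e t A)))"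
    unfolding Pi_E by (simp add: bind_assoc_pmf bind_map_pmf)
  also have "\<dots> = lazy_run p (Probe e t A)"
    unfolding lazy_run_Probe
  proof (intro bind_pmf_cong refl)
    fix b assume b: "b \<in> set_pmf (bernoulli_pmf (p e))"
    show "bind_pmf (?\<Pi> E') (\<lambda>act. run (act(e := b)) (Probe e t A)) =
      (if b then bind_pmf A (\<lambda>(accept, s).
              map_pmf (\<lambda>(es, M). (e # es, if accept then insert e M else M)) (lazy_run p s))
       else map_pmf (\<lambda>(es, M). (e # es, M)) (lazy_run p t))"
    proof (cases b)
      case True
      then have bT: "True \<in> set_pmf (bernoulli_pmf (p e))"
        using b by simp
      have "bind_pmf (?\<Pi> E') (\<lambda>act. run (act(e := b)) (Probe e t A)) =
          bind_pmf (?\<Pi> E') (\<lambda>act. bind_pmf A (\<lambda>(accept, s).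
            map_pmf (\<lambda>(es, M). (e # es, if accept then insert e M else M)) (run act s)))"
      proof (intro bind_pmf_cong refl)
        fix act assume act: "act \<in> set_pmf (?\<Pi> E')"
        have "bind_pmf A (\<lambda>(accept, s). map_pmf (\<lambda>(es, M). (e # es, if accept then insert e M else M))
               (run (act(e := True)) s)) =
            bind_pmf A (\<lambda>(accept, s). map_pmf (\<lambda>(es, M). (e # es, if accept then insert e M else M))
               (run act s))"
        proof (intro bind_pmf_cong refl, clarify)
          fix accept s assume s: "(accept, s) \<in> set_pmf A"
          show "map_pmf (\<lambda>(es, M). (e # es, if accept then insert e M else M)) (run (act(e := True)) s) =
              map_pmf (\<lambda>(es, M). (e # es, if accept then insert e M else M)) (run act s)"
            using active_branch[OF act bT s] by simp
        qed
        then show "run (act(e := b)) (Probe e t A) =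
            bind_pmf A (\<lambda>(accept, s). map_pmf (\<lambda>(es, M). (e # es, if accept then insert e M else M))
               (run act s))"
          using True by (simp add: run_Probe)
      qed
      \<comment> \<open>The draw from \<open>A\<close> is independent of the states on
        \<open>E'\<close>. Exchanging the two draws isolates one subtree at a time for the induction
        hypothesis.\<close>
      also have "\<dots> = bind_pmf A (\<lambda>(accept, s).
            map_pmf (\<lambda>(es, M). (e # es, if accept then insert e M else M))
              (bind_pmf (?\<Pi> E') (\<lambda>act. run act s)))"
        by (subst bind_commute_pmf) (simp add: map_bind_pmf case_prod_beta')
      also have "\<dots> = bind_pmf A (\<lambda>(accept, s).
            map_pmf (\<lambda>(es, M). (e # es, if accept then insert e M else M)) (lazy_run p s))"
      proof (intro bind_pmf_cong refl, clarify)
        fix accept s assume s: "(accept, s) \<in> set_pmf A"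
        have "bind_pmf (?\<Pi> E') (\<lambda>act. run act s) = lazy_run p s"
        proof (rule Probe.IH(2)[OF s _ E'(3)])
          show "s \<in> Basic_BNFs.snds (accept, s)" by simp
          fix act es M assume "act \<in> set_pmf (?\<Pi> E')" "(es, M) \<in> set_pmf (run act s)"
          then show "distinct es \<and> set es \<subseteq> E'"
            using active_branch[OF _ bT s, of act] by blast
        qed
        then show "map_pmf (\<lambda>(es, M). (e # es, if accept then insert e M else M))
              (bind_pmf (?\<Pi> E') (\<lambda>act. run act s)) =
            map_pmf (\<lambda>(es, M). (e # es, if accept then insert e M else M)) (lazy_run p s)"
          by simp
      qed
      finally show ?thesis
        using True by simp
    next
      case False
      then have bF: "False \<in> set_pmf (bernoulli_pmf (p e))"
        using b by simp
      have "bind_pmf (?\<Pi> E') (\<lambda>act. run act t) = lazy_run p t"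
      proof (rule Probe.IH(1)[OF E'(3)])
        fix act es M assume "act \<in> set_pmf (?\<Pi> E')" "(es, M) \<in> set_pmf (run act t)"
        then show "distinct es \<and> set es \<subseteq> E'"
          using inactive_branch[OF _ bF, of act] by blast
      qed
      moreover have "bind_pmf (?\<Pi> E') (\<lambda>act. run (act(e := b)) (Probe e t A)) =
          map_pmf (\<lambda>(es, M). (e # es, M)) (bind_pmf (?\<Pi> E') (\<lambda>act. run act t))"
        unfolding map_bind_pmf
      proof (intro bind_pmf_cong refl)
        fix act assume "act \<in> set_pmf (?\<Pi> E')"
        then have "run (act(e := False)) t = run act t"
          using inactive_branch[OF _ bF] by blast
        then show "run (act(e := b)) (Probe e t A) = map_pmf (\<lambda>(es, M). (e # es, M)) (run act t)"
          using False by (simp add: run_Probe)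
      qed
      ultimately show ?thesis
        using False by simp
    qed
  qed
  finally show ?case .
qed

section \<open>Drawn strings compared with executions of the algorithm\<close>

lemma snds_Pair: "y \<in> Basic_BNFs.snds (x, y)"
  by simp

text \<open>Provides membership in \<open>C v\<close>. An accepted \<open>e\<close> is put only
  before a string of the inactive branch, and only if that branch is reachable, so \<open>e\<close>
  followed by an execution of that branch is a genuine execution. Every other case merely drops
  \<open>e\<close>.\<close>

lemma nonadaptive_subseq_lazy_run:
  assumes "s \<in> set_pmf (nonadaptive p I t)"
  shows "\<exists>(es, M) \<in> set_pmf (lazy_run p t). subseq s (filter (\<lambda>e. e \<in> I) es)"
  using assms
proof (induction t arbitrary: s)
  case (Randomize A)
  then obtain t where t: "t \<in> set_pmf A" "s \<in> set_pmf (nonadaptive p I t)"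
    by (auto simp: nonadaptive_Randomize)
  obtain es M where "(es, M) \<in> set_pmf (lazy_run p t)" "subseq s (filter (\<lambda>e. e \<in> I) es)"
    using Randomize.IH[OF t] by auto
  then show ?case
    using t(1) by (intro bexI[where x = "(es, M)"]) (auto simp: lazy_run_Randomize)
next
  case (Probe e t A)
  have active_branch: ?case
    if acs: "(accept, a) \<in> set_pmf A" "True \<in> set_pmf (bernoulli_pmf (p e))"
      and s: "s \<in> set_pmf (nonadaptive p I a)" for accept a
  proof -
    obtain es M where "(es, M) \<in> set_pmf (lazy_run p a)" "subseq s (filter (\<lambda>e. e \<in> I) es)"
      using Probe.IH(2)[OF acs(1) snds_Pair s] by auto
    then show ?thesis
      by (intro bexI[OF _ lazy_run_Probe_activeI[where p = p and e = e, OF acs(2,1)]]) auto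
  qed
  \<comment> \<open>The head \<open>e\<close> of the execution is exposed because the accepting case
    keeps it, while the simulating case drops it.\<close>
  have inactive_branch: "\<exists>(es, M) \<in> set_pmf (lazy_run p (Probe e t A)).
      \<exists>es'. es = e # es' \<and> subseq s' (filter (\<lambda>e. e \<in> I) es')"
    if "False \<in> set_pmf (bernoulli_pmf (p e))"
      and s: "s' \<in> set_pmf (nonadaptive p I t)" for s'
  proof -
    obtain es M where "(es, M) \<in> set_pmf (lazy_run p t)" "subseq s' (filter (\<lambda>e. e \<in> I) es)"
      using Probe.IH(1)[OF s] by auto
    then show ?thesis
      by (intro bexI[OF _ lazy_run_Probe_inactiveI[where p = p and e = e, OF that(1)]]) auto
  qed
  obtain accept a where a: "(accept, a) \<in> set_pmf A"
    and s: "s \<in> set_pmf (if e \<in> I \<and> accept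
       then if False \<in> set_pmf (bernoulli_pmf (p e))
            then map_pmf (Cons e) (nonadaptive p I t) else return_pmf [e]
       else bind_pmf (bernoulli_pmf (p e))
              (\<lambda>active. if active then nonadaptive p I a else nonadaptive p I t))"
    using Probe.prems unfolding nonadaptive_Probe by auto
  consider
      (inactive_Cons) s' where "e \<in> I" "False \<in> set_pmf (bernoulli_pmf (p e))" "s = e # s'"
        "s' \<in> set_pmf (nonadaptive p I t)"
    | (single) "e \<in> I" "s = [e]"
    | (active) "True \<in> set_pmf (bernoulli_pmf (p e))" "s \<in> set_pmf (nonadaptive p I a)"
    | (inactive) "False \<in> set_pmf (bernoulli_pmf (p e))" "s \<in> set_pmf (nonadaptive p I t)"
    using s by (auto split: if_splits simp del: set_pmf_bernoulli) (metis (full_types))+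
  then show ?case
  proof cases
    case inactive_Cons
    then obtain es M where "(e # es, M) \<in> set_pmf (lazy_run p (Probe e t A))"
      "subseq s' (filter (\<lambda>e. e \<in> I) es)"
      using inactive_branch[of s'] by auto
    then show ?thesis
      using inactive_Cons by (intro bexI[where x = "(e # es, M)"]) auto
  next
    case single
    \<comment> \<open>Every execution of this tree begins with \<open>e\<close>, so any of them
      contains \<open>[e]\<close> after filtering by \<open>I\<close>.\<close>
    obtain es M where esM: "(es, M) \<in> set_pmf (lazy_run p (Probe e t A))"
      using set_pmf_not_empty[of "lazy_run p (Probe e t A)"] by fastforce
    then have "\<exists>es'. es = e # es'"
      by (auto simp: lazy_run_Probe split: if_splits simp del: set_pmf_bernoulli)
    then show ?thesis
      using esM single by (intro bexI[OF _ esM]) auto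
  next
    case active
    then show ?thesis using active_branch a by blast
  next
    case inactive
    then obtain es M where "(e # es, M) \<in> set_pmf (lazy_run p (Probe e t A))"
      "subseq s (filter (\<lambda>e. e \<in> I) es)"
      using inactive_branch[of s] by auto
    then show ?thesis
      by (intro bexI[where x = "(e # es, M)"]) auto
  qed
qed auto


text \<open>Induction on the tree with the convex combination from the overview. Since outputs meet
  \<open>I\<close> at most once, accepting \<open>e\<close> in \<open>I\<close> settles the matched
  edge; this is why \<open>nonadaptive\<close> may forget the active branch in that case.\<close>

lemma matched_edge_lazy_run:
  assumes "\<And>es M a b. (es, M) \<in> set_pmf (lazy_run p t) \<Longrightarrow> a \<in> M \<inter> I \<Longrightarrow> b \<in> M \<inter> I \<Longrightarrow> a = b"
  shows "map_pmf (\<lambda>(es, M). matched_edge I M) (lazy_run p t) =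
    bind_pmf (nonadaptive p I t) (first_active p)"
  using assms
proof (induction t)
  case Halt
  then show ?case
    by (simp add: matched_edge_def bind_return_pmf)
next
  case (Randomize A)
  show ?case
    unfolding lazy_run_Randomize nonadaptive_Randomize map_bind_pmf bind_assoc_pmf
  proof (intro bind_pmf_cong refl)
    fix t assume t: "t \<in> set_pmf A"
    show "map_pmf (\<lambda>(es, M). matched_edge I M) (lazy_run p t) =
        bind_pmf (nonadaptive p I t) (first_active p)"
    proof (rule Randomize.IH[OF t])
      fix es M a b assume "(es, M) \<in> set_pmf (lazy_run p t)" and ab: "a \<in> M \<inter> I" "b \<in> M \<inter> I"
      then have "(es, M) \<in> set_pmf (lazy_run p (Randomize A))"
        using t by (auto simp: lazy_run_Randomize)
      from Randomize.prems[OF this ab] show "a = b" .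
    qed
  qed
next
  case (Probe e t A)
  let ?B = "bernoulli_pmf (p e)"
  let ?L = "\<lambda>s. bind_pmf (nonadaptive p I s) (first_active p)"
  \<comment> \<open>The law of the matched edge once the decision \<open>(accept, s)\<close> and the
    state of \<open>e\<close> are known; both sides are reduced to it.\<close>
  let ?next = "\<lambda>accept s active. if active
      then if e \<in> I \<and> accept then return_pmf (Some e) else ?L s else ?L t"
  have active_branch:
    "map_pmf (\<lambda>(es, M). matched_edge I (if accept then insert e M else M)) (lazy_run p s) =
      (if e \<in> I \<and> accept then return_pmf (Some e) else ?L s)"
    if B: "True \<in> set_pmf ?B" and s: "(accept, s) \<in> set_pmf A" for accept s
  proof (cases "e \<in> I \<and> accept")
    case True
    have "matched_edge I (insert e M) = Some e" if "(es, M) \<in> set_pmf (lazy_run p s)" for es M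
    proof -
      have "\<And>a. a \<in> insert e M \<inter> I \<Longrightarrow> a = e"
        using Probe.prems[OF lazy_run_Probe_activeI[where p = p and e = e, OF B s that], of _ e] True by auto
      then have "insert e M \<inter> I = {e}"
        using True by auto
      then show ?thesis
        by (simp add: matched_edge_def)
    qed
    then have "map_pmf (\<lambda>(es, M). matched_edge I (if accept then insert e M else M)) (lazy_run p s) =
        map_pmf (\<lambda>_. Some e) (lazy_run p s)"
      using True by (intro pmf.map_cong refl) auto
    then show ?thesis
      using True by simp
  next
    case False
    have "map_pmf (\<lambda>(es, M). matched_edge I M) (lazy_run p s) = ?L s"
    proof (rule Probe.IH(2)[OF s snds_Pair])
      fix es M a b assume "(es, M) \<in> set_pmf (lazy_run p s)" and "a \<in> M \<inter> I" "b \<in> M \<inter> I"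
      then show "a = b"
        using Probe.prems[OF lazy_run_Probe_activeI[where p = p and e = e, OF B s], of es M a b] by auto
    qed
    moreover have "matched_edge I (if accept then insert e M else M) = matched_edge I M" for M
    proof -
      have "(if accept then insert e M else M) \<inter> I = M \<inter> I"
        using False by auto
      then show ?thesis
        by (simp only: matched_edge_def)
    qed
    ultimately show ?thesis
      using False by auto
  qed
  have inactive_branch: "map_pmf (\<lambda>(es, M). matched_edge I M) (lazy_run p t) = ?L t"
    if B: "False \<in> set_pmf ?B"
  proof (rule Probe.IH(1))
    fix es M a b assume "(es, M) \<in> set_pmf (lazy_run p t)" and "a \<in> M \<inter> I" "b \<in> M \<inter> I"
    then show "a = b"
      using Probe.prems[OF lazy_run_Probe_inactiveI[where p = p and e = e, OF B], of es M a b] by auto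
  qed
  \<comment> \<open>Drawing from \<open>A\<close> even when \<open>e\<close> is inactive changes
    nothing, as \<open>?next\<close> then ignores the draw. Both states now have the same
    shape.\<close>
  have "map_pmf (\<lambda>(es, M). matched_edge I M) (lazy_run p (Probe e t A)) =
      bind_pmf ?B (\<lambda>active. bind_pmf A (\<lambda>(accept, s). ?next accept s active))"
    unfolding lazy_run_Probe map_bind_pmf
  proof (intro bind_pmf_cong refl)
    fix active assume B: "active \<in> set_pmf ?B"
    show "map_pmf (\<lambda>(es, M). matched_edge I M) (if active
         then bind_pmf A (\<lambda>(accept, s).
                map_pmf (\<lambda>(es, M). (e # es, if accept then insert e M else M)) (lazy_run p s))
         else map_pmf (\<lambda>(es, M). (e # es, M)) (lazy_run p t)) =
      bind_pmf A (\<lambda>(accept, s). ?next accept s active)"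
    proof (cases active)
      case True
      have "map_pmf (\<lambda>(es, M). matched_edge I M) (bind_pmf A (\<lambda>(accept, s).
              map_pmf (\<lambda>(es, M). (e # es, if accept then insert e M else M)) (lazy_run p s))) =
          bind_pmf A (\<lambda>(accept, s).
            map_pmf (\<lambda>(es, M). matched_edge I (if accept then insert e M else M)) (lazy_run p s))"
        by (simp add: map_bind_pmf case_prod_beta' pmf.map_comp o_def)
      also have "\<dots> = bind_pmf A (\<lambda>(accept, s). ?next accept s True)"
        using active_branch B True by (intro bind_pmf_cong refl) auto
      finally show ?thesis
        using True by simp
    next
      case False
      then show ?thesis
        using inactive_branch B by (simp add: pmf.map_comp o_def case_prod_beta')
    qed
  qed
  \<comment> \<open>This exchange removes the adaptivity: acceptance of \<open>e\<close> is decided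
    before the state of \<open>e\<close> is known.\<close>
  also have "\<dots> = bind_pmf A (\<lambda>(accept, s). bind_pmf ?B (?next accept s))"
    by (subst bind_commute_pmf) (simp add: case_prod_beta')
  also have "\<dots> = ?L (Probe e t A)"
    unfolding nonadaptive_Probe bind_assoc_pmf
  proof (intro bind_pmf_cong refl, clarify)
    fix accept s assume s: "(accept, s) \<in> set_pmf A"
    consider (accept) "e \<in> I \<and> accept" "False \<in> set_pmf ?B"
      | (certain) "e \<in> I \<and> accept" "False \<notin> set_pmf ?B" | (reject) "\<not> (e \<in> I \<and> accept)"
      by blast
    then show "bind_pmf ?B (?next accept s) =
      bind_pmf (if e \<in> I \<and> accept
         then if False \<in> set_pmf ?B then map_pmf (Cons e) (nonadaptive p I t) else return_pmf [e]
         else bind_pmf ?B (\<lambda>active. if active then nonadaptive p I s else nonadaptive p I t))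
       (first_active p)"
    proof cases
      case accept
      \<comment> \<open>The rest of the string is drawn independently of the coin for
        \<open>e\<close>, so the order of the two draws does not matter.\<close>
      have "bind_pmf (map_pmf (Cons e) (nonadaptive p I t)) (first_active p) =
          bind_pmf ?B (\<lambda>active. bind_pmf (nonadaptive p I t)
            (\<lambda>s. if active then return_pmf (Some e) else first_active p s))"
        unfolding bind_map_pmf first_active.simps by (rule bind_commute_pmf)
      also have "\<dots> = bind_pmf ?B (?next accept s)"
        using accept by (intro bind_pmf_cong refl) simp
      finally show ?thesis
        using accept by simp
    next
      case certain
      \<comment> \<open>The coin shows \<open>True\<close> almost surely, so the scan stops at
        \<open>e\<close> whatever follows it; \<open>[e]\<close> has the same law.\<close>
      have "bind_pmf ?B (?next accept s) =
          bind_pmf ?B (\<lambda>active. if active then return_pmf (Some e) else first_active p [])"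
        using certain by (intro bind_pmf_cong refl) (auto split: if_splits)
      then show ?thesis
        using certain by (simp add: bind_return_pmf)
    next
      case reject
      have "bind_pmf (bind_pmf ?B (\<lambda>active. if active then nonadaptive p I s else nonadaptive p I t))
          (first_active p) = bind_pmf ?B (?next accept s)"
        using reject unfolding bind_assoc_pmf by (intro bind_pmf_cong refl) auto
      then show ?thesis
        unfolding if_not_P[OF reject] by (rule sym)
    qed
  qed
  finally show ?case .
qed

section \<open>Strings: first active edge, subsequences, distinctness\<close>

lemma pmf_first_active:
  assumes "distinct es" and "\<And>e. e \<in> set es \<Longrightarrow> 0 \<le> p e \<and> p e \<le> 1"
  shows "pmf (first_active p es) (Some f) =
    (if f \<in> set es then p f * inactive_prob p (before es f) else 0)"
  using assms
proof (induction es)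
  case (Cons e es)
  have "0 \<le> p e" "p e \<le> 1"
    using Cons.prems(2) by auto
  then have "pmf (first_active p (e # es)) (Some f) =
      (if f = e then p e else 0) + pmf (first_active p es) (Some f) * (1 - p e)"
    by (simp add: pmf_bind)
  moreover have "pmf (first_active p es) (Some f) =
      (if f \<in> set es then p f * inactive_prob p (before es f) else 0)"
    using Cons by auto
  \<comment> \<open>By distinctness the two summands are never both nonzero: for
    \<open>f = e\<close> the tail contributes 0 and \<open>before\<close> is empty; otherwise
    \<open>e\<close> adds the factor \<open>1 - p e\<close>.\<close>
  ultimately show ?case
    using Cons.prems(1) by (auto simp: before_def inactive_prob_def simp del: first_active.simps)
qed simp

text \<open>A permutation moves the subsequence to the front in its own order, where it is a prefix
  and hence a substring.\<close>

lemma downward_closed_subseq: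
  assumes "downward_closed C" "es \<in> C" "subseq es' es"
  shows "es' \<in> C"
proof -
  have "mset es' \<subseteq># mset es"
    using assms(3)
  proof (induction rule: list_emb.induct)
    case (list_emb_Cons xs ys y)
    then show ?case
      by (metis mset.simps(2) multi_psub_of_add_self subset_mset.less_imp_le subset_mset.order_trans)
  qed auto
  then obtain N where N: "mset es = mset es' + N"
    by (metis subset_mset.add_diff_inverse)
  obtain rest where "mset rest = N"
    using ex_mset by blast
  then have "mset (es' @ rest) = mset es"
    using N by simp
  then have "es' @ rest \<in> C"
    using assms(1,2) unfolding downward_closed_def by blast
  then show ?thesis
    using assms(1) unfolding downward_closed_def by blast
qed

text \<open>Both copies of a repeated edge would survive in the filter for its own endpoint in
  \<open>V\<close>. This supplies the distinctness required for sampling on demand.\<close>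

lemma distinct_if_distinct_filters:
  assumes "set es \<subseteq> U \<times> V"
    and "\<And>v. v \<in> V \<Longrightarrow> distinct (filter (\<lambda>e. e \<in> incident U v) es)"
  shows "distinct es"
  using assms
proof (induction es)
  case (Cons e es)
  have "distinct (filter (\<lambda>e. e \<in> incident U v) es)" if "v \<in> V" for v
    using Cons.prems(2)[OF that] by (auto split: if_splits)
  then have "distinct es"
    using Cons by auto
  moreover have "e \<notin> set es"
    using Cons.prems(2)[of "snd e"] Cons.prems(1) by (auto simp: incident_def)
  ultimately show ?case
    by simp
qed simp

section \<open>The LP solution induced by an algorithm\<close>

lemma ex_LP_feasible_objective_eq_expected_weight:
  fixes U :: "'u set" and V :: "'v set"
  assumes graph: "stochastic_graph U V w p"
    and constr: "probing_constraints U V C"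
    and t: "t \<in> offline_algorithms U V p C"
  shows "\<exists>x. LP_feasible U V p C x \<and> LP_objective V w p C x = expected_weight U V w p t"
proof -
  have fin: "finite U" "finite V"
    and p01: "\<And>e. e \<in> U \<times> V \<Longrightarrow> 0 \<le> p e \<and> p e \<le> 1"
    using graph unfolding stochastic_graph_def by auto
  have C_strings: "distinct es \<and> set es \<subseteq> incident U v" if "v \<in> V" "es \<in> C v" for v es
    using constr that unfolding probing_constraints_def distinct_strings_def by auto
  have C_closed: "downward_closed (C v)" if "v \<in> V" for v
    using constr that unfolding probing_constraints_def by auto
  have fin_I: "finite (incident U v)" for v :: 'v
    using fin by (simp add: incident_def)
  \<comment> \<open>Finiteness lets sums over \<open>C v\<close> express expectations; over an
    infinite set such a sum would be 0 by convention.\<close>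
  have fin_C: "finite (C v)" if "v \<in> V" for v
  proof (rule finite_subset)
    show "C v \<subseteq> {es. set es \<subseteq> incident U v \<and> length es \<le> card (incident U v)}"
    proof
      fix es assume "es \<in> C v"
      then have "distinct es" "set es \<subseteq> incident U v"
        using C_strings[OF that] by auto
      then show "es \<in> {es. set es \<subseteq> incident U v \<and> length es \<le> card (incident U v)}"
        using card_mono[OF fin_I] by (simp flip: distinct_card)
    qed
    show "finite {es. set es \<subseteq> incident U v \<and> length es \<le> card (incident U v)}"
      by (rule finite_lists_length_le[OF fin_I])
  qed
  have valid: "set es \<subseteq> U \<times> V" "\<And>v. v \<in> V \<Longrightarrow> filter (\<lambda>e. e \<in> incident U v) es \<in> C v" "matching M"
    if "(es, M) \<in> set_pmf (outcome U V p t)" for es M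
    using t that unfolding offline_algorithms_def by auto
  have outcome_eq: "outcome U V p t = lazy_run p t"
    unfolding outcome_def edge_states_def
  proof (rule run_Pi_pmf_eq_lazy_run)
    fix act es M
    assume "act \<in> set_pmf (Pi_pmf (U \<times> V) False (\<lambda>e. bernoulli_pmf (p e)))"
      and "(es, M) \<in> set_pmf (run act t)"
    then have "(es, M) \<in> set_pmf (outcome U V p t)"
      unfolding outcome_def edge_states_def by auto
    note valid = valid[OF this]
    have "distinct es"
      by (rule distinct_if_distinct_filters[OF valid(1)]) (use valid(2) C_strings in blast)
    then show "distinct es \<and> set es \<subseteq> U \<times> V"
      using valid(1) by simp
  qed (use fin in simp)
  let ?L = "lazy_run p t"
  \<comment> \<open>Matched edges have been probed, and the constraints confine probes to
    \<open>U \<times> V\<close>.\<close>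
  have output_subset: "M \<subseteq> U \<times> V" if "(es, M) \<in> set_pmf ?L" for es M
  proof -
    have "(es, M) \<in> set_pmf (outcome U V p t)"
      using that outcome_eq by simp
    moreover from this have "M \<subseteq> set es"
      unfolding outcome_def set_bind_pmf using run_output_subset by blast
    ultimately show ?thesis
      using valid(1) by blast
  qed
  have output_matching: "matching M" if "(es, M) \<in> set_pmf ?L" for es M
    using valid(3) that outcome_eq by simp
  have integrable_indicator: "integrable (measure_pmf ?L) (indicator S :: _ \<Rightarrow> real)" for S
    by (rule measure_pmf.integrable_const_bound[where B = 1]) (auto simp: indicator_def)
  define P where "P e = measure_pmf.prob ?L {(es, M). e \<in> M}" for e
  define x where "x v es = pmf (nonadaptive p (incident U v) t) es" for v es
  \<comment> \<open>The probability that \<open>e\<close> is the first active edge of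
    \<open>es\<close>. The value 0 for edges outside \<open>es\<close> allows sums over all of
    \<open>C v\<close> and over all edges at \<open>v\<close>.\<close>
  define q where "q es e = (if e \<in> set es then p e * inactive_prob p (before es e) else 0)" for es e
  have support: "set_pmf (nonadaptive p (incident U v) t) \<subseteq> C v" if v: "v \<in> V" for v
  proof
    fix s assume "s \<in> set_pmf (nonadaptive p (incident U v) t)"
    then obtain es M where "(es, M) \<in> set_pmf ?L" "subseq s (filter (\<lambda>e. e \<in> incident U v) es)"
      using nonadaptive_subseq_lazy_run by fastforce
    then show "s \<in> C v"
      using downward_closed_subseq[OF C_closed[OF v]] valid(2)[OF _ v] outcome_eq by auto
  qed
  \<comment> \<open>\<open>Some e\<close> is the matched edge at \<open>v\<close> exactly when
    \<open>e\<close> is in the output. The equality of laws then gives a total probability formula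
    over the drawn string.\<close>
  have P_eq: "P e = (\<Sum>es\<in>C v. q es e * x v es)" if v: "v \<in> V" and e: "e \<in> incident U v" for v e
  proof -
    let ?I = "incident U v"
    have unique: "a = b" if "(es, M) \<in> set_pmf ?L" "a \<in> M \<inter> ?I" "b \<in> M \<inter> ?I" for es M a b
      using output_matching[OF that(1)] that(2,3) unfolding matching_def incident_def by fastforce
    have "matched_edge ?I M = Some e \<longleftrightarrow> e \<in> M" if L: "(es, M) \<in> set_pmf ?L" for es M
    proof (cases "M \<inter> ?I = {}")
      case True
      then show ?thesis
        using e by (auto simp: matched_edge_def)
    next
      case False
      then obtain a where "M \<inter> ?I = {a}"
        using unique[OF L] by blast
      then show ?thesis
        using e by (auto simp: matched_edge_def)
    qed
    then have "P e = measure_pmf.prob ?L ((\<lambda>(es, M). matched_edge ?I M) -` {Some e})"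
      unfolding P_def by (intro measure_pmf.finite_measure_eq_AE) (auto simp: AE_measure_pmf_iff)
    also have "\<dots> = pmf (bind_pmf (nonadaptive p ?I t) (first_active p)) (Some e)"
      using matched_edge_lazy_run[of p t ?I] unique by (simp add: pmf_map[symmetric])
    also have "\<dots> = (\<Sum>es\<in>C v. pmf (first_active p es) (Some e) * x v es)"
      unfolding pmf_bind x_def
      by (rule integral_measure_pmf_real[OF fin_C[OF v]]) (use support[OF v] in blast)
    also have "\<dots> = (\<Sum>es\<in>C v. q es e * x v es)"
    proof (rule sum.cong[OF refl])
      fix es assume "es \<in> C v"
      then have "\<And>f. f \<in> set es \<Longrightarrow> 0 \<le> p f \<and> p f \<le> 1"
        using C_strings[OF v] v p01 by (fastforce simp: incident_def)
      then show "pmf (first_active p es) (Some e) * x v es = q es e * x v es"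
        using C_strings[OF v \<open>es \<in> C v\<close>] by (simp add: pmf_first_active q_def)
    qed
    finally show ?thesis .
  qed
  have "LP_feasible U V p C x"
    unfolding LP_feasible_def
  proof (intro conjI ballI)
    fix v es show "0 \<le> x v es"
      by (simp add: x_def)
  next
    fix v assume v: "v \<in> V"
    show "(\<Sum>es\<in>C v. x v es) = 1"
      unfolding x_def by (rule sum_pmf_eq_1[OF fin_C[OF v] support[OF v]])
  next
    fix u assume u: "u \<in> U"
    have "(\<Sum>v\<in>V. \<Sum>es\<in>{es \<in> C v. (u, v) \<in> set es}.
        p (u, v) * inactive_prob p (before es (u, v)) * x v es) = (\<Sum>v\<in>V. P (u, v))"
    proof (rule sum.cong[OF refl])
      fix v assume v: "v \<in> V"
      have "(\<Sum>es\<in>{es \<in> C v. (u, v) \<in> set es}.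
          p (u, v) * inactive_prob p (before es (u, v)) * x v es) = (\<Sum>es\<in>C v. q es (u, v) * x v es)"
        by (rule sum.mono_neutral_cong_left) (use fin_C[OF v] in \<open>auto simp: q_def\<close>)
      then show "(\<Sum>es\<in>{es \<in> C v. (u, v) \<in> set es}.
          p (u, v) * inactive_prob p (before es (u, v)) * x v es) = P (u, v)"
        using P_eq[OF v, of "(u, v)"] u by (simp add: incident_def)
    qed
    \<comment> \<open>By linearity this is the expected number of matched edges at \<open>u\<close>,
      and a matching contains at most one of them.\<close>
    also have "(\<Sum>v\<in>V. P (u, v)) =
        measure_pmf.expectation ?L (\<lambda>y. \<Sum>v\<in>V. indicator {(es, M). (u, v) \<in> M} y)"
      by (subst Bochner_Integration.integral_sum) (auto simp: P_def integrable_indicator)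
    also have "\<dots> \<le> 1"
    proof (rule measure_pmf.integral_le_const)
      show "integrable (measure_pmf ?L)
          (\<lambda>y. \<Sum>v\<in>V. indicator {(es, M). (u, v) \<in> M} y :: real)"
        by (intro Bochner_Integration.integrable_sum integrable_indicator)
      have "(\<Sum>v\<in>V. indicator {(es, M). (u, v) \<in> M} (es, M) :: real) \<le> 1"
        if "(es, M) \<in> set_pmf ?L" for es M
      proof (cases "\<exists>v\<in>V. (u, v) \<in> M")
        case True
        then obtain v where v: "v \<in> V" "(u, v) \<in> M"
          by blast
        have "(\<Sum>v'\<in>V. indicator {(es, M). (u, v') \<in> M} (es, M) :: real) = (\<Sum>v'\<in>V. if v' = v then 1 else 0)"
        proof (intro sum.cong refl)
          fix v'
          have "(u, v') \<in> M \<longleftrightarrow> v' = v"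
            using v(2) output_matching[OF that]
            unfolding matching_def by (metis fst_conv snd_conv)
          then show "indicator {(es, M). (u, v') \<in> M} (es, M) = (if v' = v then 1 else 0 :: real)"
            by (simp add: indicator_def)
        qed
        then show ?thesis
          using fin by simp
      qed (simp add: indicator_def)
      then show "AE y in measure_pmf ?L. (\<Sum>v\<in>V. indicator {(es, M). (u, v) \<in> M} y :: real) \<le> 1"
        by (auto simp: AE_measure_pmf_iff)
    qed
    finally show "(\<Sum>v\<in>V. \<Sum>es\<in>{es \<in> C v. (u, v) \<in> set es}.
        p (u, v) * inactive_prob p (before es (u, v)) * x v es) \<le> 1" .
  qed
  moreover have "LP_objective V w p C x = expected_weight U V w p t"
  proof -
    have val_eq: "val w p es = (\<Sum>e\<in>incident U v. w e * q es e)" if "v \<in> V" "es \<in> C v" for v es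
    proof -
      have "val w p es = (\<Sum>e\<in>set es. p e * w e * inactive_prob p (before es e))"
        unfolding val_def using C_strings[OF that] by (simp add: sum_list_distinct_conv_sum_set)
      also have "\<dots> = (\<Sum>e\<in>incident U v. w e * q es e)"
        by (rule sum.mono_neutral_cong_left) (use C_strings[OF that] fin_I in \<open>auto simp: q_def\<close>)
      finally show ?thesis .
    qed
    have "LP_objective V w p C x = (\<Sum>v\<in>V. \<Sum>es\<in>C v. \<Sum>e\<in>incident U v. w e * (q es e * x v es))"
      unfolding LP_objective_def by (intro sum.cong refl) (simp add: val_eq sum_distrib_right mult.assoc)
    \<comment> \<open>Grouping by edges instead of strings makes the inner sum the probability from
      \<open>P_eq\<close>.\<close>
    also have "\<dots> = (\<Sum>v\<in>V. \<Sum>e\<in>incident U v. w e * P e)"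
      by (intro sum.cong refl) (subst sum.swap, simp add: P_eq sum_distrib_left)
    also have "\<dots> = (\<Sum>v\<in>V. \<Sum>u\<in>U. w (u, v) * P (u, v))"
      unfolding incident_def by (simp add: sum.cartesian_product')
    also have "\<dots> = (\<Sum>e\<in>U \<times> V. w e * P e)"
      by (subst sum.swap) (simp add: sum.cartesian_product')
    also have "\<dots> = measure_pmf.expectation ?L (\<lambda>y. \<Sum>e\<in>U \<times> V. w e * indicator {(es, M). e \<in> M} y)"
      by (subst Bochner_Integration.integral_sum) (auto simp: P_def integrable_indicator)
    also have "\<dots> = measure_pmf.expectation ?L (\<lambda>(es, M). \<Sum>e\<in>M. w e)"
    proof (rule integral_cong_AE)
      have "(\<Sum>e\<in>U \<times> V. w e * indicator {(es, M). e \<in> M} (es, M)) = (\<Sum>e\<in>M. w e)"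
        if "(es, M) \<in> set_pmf ?L" for es M
        by (rule sum.mono_neutral_cong_right) (use fin output_subset[OF that] in \<open>auto simp: indicator_def\<close>)
      then show "AE y in measure_pmf ?L. (\<Sum>e\<in>U \<times> V. w e * indicator {(es, M). e \<in> M} y) =
          (case y of (es, M) \<Rightarrow> \<Sum>e\<in>M. w e)"
        by (auto simp: AE_measure_pmf_iff)
    qed simp_all
    finally show ?thesis
      unfolding expected_weight_def outcome_eq .
  qed
  ultimately show ?thesis
    by blast
qed

theorem theorem6:
  fixes U :: "'u set" and V :: "'v set"
    and w p :: "'u \<times> 'v \<Rightarrow> real"
    and C :: "'v \<Rightarrow> ('u \<times> 'v) list set"
  assumes "stochastic_graph U V w p"
    and "probing_constraints U V C"
  shows "OPT U V w p C \<le> LPOPT U V w p C"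
  unfolding OPT_def
proof (rule SUP_least)
  fix t assume "t \<in> offline_algorithms U V p C"
  \<comment> \<open>Each algorithm yields its own feasible point of equal value, so the bound on the
    supremum follows pointwise.\<close>
  then obtain x where "LP_feasible U V p C x" "LP_objective V w p C x = expected_weight U V w p t"
    using ex_LP_feasible_objective_eq_expected_weight[OF assms] by blast
  then show "ereal (expected_weight U V w p t) \<le> LPOPT U V w p C"
    unfolding LPOPT_def by (intro SUP_upper2[of x]) auto
qed

end
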